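(* Let $\Sigma_i=\begin{bmatrix}A_i&B_i\\C_i&D_i\end{bmatrix}$ be a linear system, and for invertible resistance matrices $R>0$ let $\Sigma(R)=\begin{bmatrix}A&B\\C&D\end{bmatrix}$ be its external Cayley transform. Then the following are equivalent: (1) $\Sigma_i$ is impedance passive; (2) $\Sigma(R)$ (exists and) is scattering passive for some invertible $R>0$; and (3) $\Sigma(R)$ (exists and) is scattering passive for all invertible $R>0$. The equivalences remain true if the word "passive" is replaced by "conservative" throughout.
   Context: All matrices and signals are real and finite-dimensional; norms and inner products are Euclidean. A linear system $\Sigma=\begin{bmatrix}A&B\\C&D\end{bmatrix}$ is the quadruple of matrices in $x'(t)=Ax(t)+Bu(t)$, $y(t)=Cx(t)+Du(t)$, $t\in I$ ($I\subset\mathbb R$ an interval, signals sufficiently smooth for classical solvability), where $u$ and $y$ have the same dimension $m$, assumed even, and are split into two parts of dimension $m/2$. $\Sigma$ is impedance passive if all functions $u,x,y$ satisfying these equations satisfy $\frac{d}{dt}\|x(t)\|^2\le2\langle u(t),y(t)\rangle$ for all $t\in I$, and scattering passive if they satisfy $\frac{d}{dt}\|x(t)\|^2\le\|u(t)\|^2-\|y(t)\|^2$ for all $t\in I$; it is impedance (scattering) conservative if the respective inequality always holds as an equality. A resistance matrix is an $m\times m$ block diagonal matrix $R=\begin{bmatrix}R_1&0\\0&R_2\end{bmatrix}$ (blocks of size $m/2$) that is symmetric, positive ($R>0$) and invertible. The external Cayley transform $\Sigma(R)=\begin{bmatrix}A&B\\C&D\end{bmatrix}$ of $\Sigma_i$,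 which exists when $D_i+R$ is invertible, is $$A=A_i-B_i(D_i+R)^{-1}C_i,\quad B=\sqrt2B_i(D_i+R)^{-1}R^{1/2},\quad C=\sqrt2R^{1/2}(D_i+R)^{-1}C_i,\quad D=I-2R^{1/2}(D_i+R)^{-1}R^{1/2}.$$ Conversely, $A_i=A+B(I-D)^{-1}C$, $B_i=\sqrt2B(I-D)^{-1}R^{1/2}$, $C_i=\sqrt2R^{1/2}(I-D)^{-1}C$, $D_i=R^{1/2}(I-D)^{-1}(I+D)R^{1/2}$. *)

theory Defs
  imports "HOL-Analysis.Analysis"
begin

record ('n::finite, 'm::finite) lin_system =
  sysA :: "real^'n^'n"
  sysB :: "real^'m^'n"
  sysC :: "real^'n^'m"
  sysD :: "real^'m^'m"

text \<open>Classical solutions on the interval \<open>I\<close>: a continuous input and a differentiable state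
  (then \<open>x\<close> is continuously differentiable and \<open>y\<close> is continuous). Derivatives are taken within
  \<open>I\<close>, hence are one-sided at those endpoints that belong to \<open>I\<close>.\<close>

definition trajectory ::
    "real set \<Rightarrow> ('n::finite, 'm::finite) lin_system \<Rightarrow>
      (real \<Rightarrow> real^'m) \<Rightarrow> (real \<Rightarrow> real^'n) \<Rightarrow> (real \<Rightarrow> real^'m) \<Rightarrow> bool" where
  "trajectory I S u x y \<longleftrightarrow>
     continuous_on I u \<and>
     (\<forall>t\<in>I. (x has_vector_derivative (sysA S *v x t + sysB S *v u t)) (at t within I) \<and>
            y t = sysC S *v x t + sysD S *v u t)"

definition impedance_passive :: "real set \<Rightarrow> ('n::finite, 'm::finite) lin_system \<Rightarrow> bool" where
  "impedance_passive I S \<longleftrightarrow>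
     (\<forall>u x y. trajectory I S u x y \<longrightarrow>
        (\<forall>t\<in>I. vector_derivative (\<lambda>s. (norm (x s))\<^sup>2) (at t within I) \<le> 2 * (u t \<bullet> y t)))"

definition impedance_conservative :: "real set \<Rightarrow> ('n::finite, 'm::finite) lin_system \<Rightarrow> bool" where
  "impedance_conservative I S \<longleftrightarrow>
     (\<forall>u x y. trajectory I S u x y \<longrightarrow>
        (\<forall>t\<in>I. vector_derivative (\<lambda>s. (norm (x s))\<^sup>2) (at t within I) = 2 * (u t \<bullet> y t)))"

definition scattering_passive :: "real set \<Rightarrow> ('n::finite, 'm::finite) lin_system \<Rightarrow> bool" where
  "scattering_passive I S \<longleftrightarrow>
     (\<forall>u x y. trajectory I S u x y \<longrightarrow>
        (\<forall>t\<in>I. vector_derivative (\<lambda>s. (norm (x s))\<^sup>2) (at t within I)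
                 \<le> (norm (u t))\<^sup>2 - (norm (y t))\<^sup>2))"

definition scattering_conservative :: "real set \<Rightarrow> ('n::finite, 'm::finite) lin_system \<Rightarrow> bool" where
  "scattering_conservative I S \<longleftrightarrow>
     (\<forall>u x y. trajectory I S u x y \<longrightarrow>
        (\<forall>t\<in>I. vector_derivative (\<lambda>s. (norm (x s))\<^sup>2) (at t within I)
                 = (norm (u t))\<^sup>2 - (norm (y t))\<^sup>2))"

text \<open>The even signal dimension \<open>m\<close> and the splitting of signals into two halves are encoded by
  the index type \<open>'k + 'k\<close>, so that \<open>m = 2 * CARD('k)\<close>.\<close>

definition block_diag ::
    "real^'k^'k \<Rightarrow> real^'k^'k \<Rightarrow> real^('k::finite + 'k)^('k + 'k)" where
  "block_diag P Q =
     (\<chi> i j. case (i, j) of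
                (Inl a, Inl b) \<Rightarrow> P $ a $ b
              | (Inr a, Inr b) \<Rightarrow> Q $ a $ b
              | _ \<Rightarrow> 0)"

definition resistance_matrix :: "real^('k::finite + 'k)^('k + 'k) \<Rightarrow> bool" where
  "resistance_matrix R \<longleftrightarrow>
     (\<exists>R1 R2. R = block_diag R1 R2) \<and>
     transpose R = R \<and> (\<forall>v. v \<noteq> 0 \<longrightarrow> 0 < v \<bullet> (R *v v)) \<and> invertible R"

text \<open>The symmetric positive semidefinite square root; it exists and is unique if \<open>R\<close> is
  symmetric positive semidefinite.\<close>

definition mat_sqrt :: "real^'m^'m \<Rightarrow> real^'m^'m" where
  "mat_sqrt R = (THE S. transpose S = S \<and> (\<forall>v. 0 \<le> v \<bullet> (S *v v)) \<and> S ** S = R)"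

definition cayley_exists ::
    "('n::finite, 'm::finite) lin_system \<Rightarrow> real^'m^'m \<Rightarrow> bool" where
  "cayley_exists S R \<longleftrightarrow> invertible (sysD S + R)"

definition external_cayley ::
    "('n::finite, 'm::finite) lin_system \<Rightarrow> real^'m^'m \<Rightarrow> ('n, 'm) lin_system" where
  "external_cayley S R =
     (let K = matrix_inv (sysD S + R); H = mat_sqrt R in
      \<lparr> sysA = sysA S - sysB S ** K ** sysC S,
        sysB = sqrt 2 *\<^sub>R (sysB S ** K ** H),
        sysC = sqrt 2 *\<^sub>R (H ** K ** sysC S),
        sysD = mat 1 - 2 *\<^sub>R (H ** K ** H) \<rparr>)"

end

theory Submission
  imports Defs
begin

text \<open>
  Passivity is quantified over trajectories, but it is a pointwise statement. Along a trajectory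
  \<open>d/dt \<parallel>x\<parallel>\<^sup>2 = 2 \<langle>x, A x + B u\<rangle>\<close>, so the inequality at time \<open>t\<close> only involves \<open>x t\<close> and \<open>u t\<close>; and
  every pair of vectors occurs as \<open>(x t, u t)\<close> for some trajectory, because a constant input admits
  a global solution through any initial state. Each of the four notions is therefore equivalent to
  an algebraic condition on all pairs \<open>(x, u)\<close> (\<open>trajectory_property_iff_pointwise\<close>).

  On the algebraic side the external Cayley transform is a change of signals. With \<open>H = R\<^sup>1\<^sup>/\<^sup>2\<close> put
  \<open>\<surd>2 H a = y + R u\<close> and \<open>\<surd>2 H b = y - R u\<close>. Then \<open>\<parallel>a\<parallel>\<^sup>2 - \<parallel>b\<parallel>\<^sup>2 = 2 \<langle>u, y\<rangle>\<close>, and the system written in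
  the signals \<open>(a, x, b)\<close> is \<open>\<Sigma>(R)\<close>, with the same value of \<open>x'\<close>
  (\<open>external_cayley_wave_variables\<close>). For fixed \<open>x\<close> the correspondence between \<open>u\<close> and \<open>a\<close> is
  bijective as soon as \<open>D + R\<close> is invertible, so the impedance condition on \<open>\<Sigma>\<close> and the scattering
  condition on \<open>\<Sigma>(R)\<close> are the same condition (\<open>external_cayley_pointwise\<close>). Inequality and equality
  are handled at once by leaving the relation \<open>P\<close> between stored and supplied power arbitrary.

  If \<open>\<Sigma>\<close> is impedance passive, in particular if it is impedance conservative, taking \<open>x = 0\<close> gives \<open>\<langle>u, D u\<rangle> \<ge> 0\<close>, so \<open>D + R\<close> is positive definite
  and \<open>\<Sigma>(R)\<close> exists for every \<open>R\<close>. As the identity is a resistance matrix, "for all \<open>R\<close>" implies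
  "for some \<open>R\<close>".

  Two analytic facts are developed on the way: linear differential equations with a
  constant forcing term have global solutions, and a positive definite symmetric matrix has exactly
  one positive square root.
\<close>

section \<open>Matrices as quadratic forms\<close>

lemma dot_symmetric_matrix:
  fixes M :: "real^'n^'n"
  assumes "transpose M = M"
  shows "(M *v v) \<bullet> w = v \<bullet> (M *v w)"
  by (metis assms dot_lmul_matrix transpose_matrix_vector)

lemma matrix_inv_inverse:
  fixes M :: "real^'n^'n"
  assumes "invertible M"
  shows "M ** matrix_inv M = mat 1" and "matrix_inv M ** M = mat 1"
proof -
  have "M ** matrix_inv M = mat 1 \<and> matrix_inv M ** M = mat 1"
    unfolding matrix_inv_def using assms unfolding invertible_def by (rule someI_ex)
  then show "M ** matrix_inv M = mat 1" and "matrix_inv M ** M = mat 1" by auto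
qed

lemma invertible_if_positive_definite:
  fixes M :: "real^'n^'n"
  assumes "\<And>v. v \<noteq> 0 \<Longrightarrow> 0 < v \<bullet> (M *v v)"
  shows "invertible M"
proof -
  have "v = w" if "M *v v = M *v w" for v w
  proof (rule ccontr)
    assume "v \<noteq> w"
    then have "0 < (v - w) \<bullet> (M *v (v - w))" using assms by simp
    then show False using that by (simp add: matrix_vector_mult_diff_distrib)
  qed
  then show ?thesis
    by (simp add: invertible_left_inverse matrix_left_invertible_injective inj_on_def)
qed

section \<open>From trajectories to pairs of vectors\<close>

lemma norm_sq_has_derivative:
  fixes x :: "real \<Rightarrow> real^'n"
  assumes "(x has_vector_derivative d) (at t within I)"
  shows "((\<lambda>s. (norm (x s))\<^sup>2) has_vector_derivative 2 * (x t \<bullet> d)) (at t within I)"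
proof -
  have "((\<lambda>s. x s \<bullet> x s) has_derivative (\<lambda>h. x t \<bullet> (h *\<^sub>R d) + (h *\<^sub>R d) \<bullet> x t)) (at t within I)"
    using assms unfolding has_vector_derivative_def
    by (rule has_derivative_inner) (use assms in \<open>simp add: has_vector_derivative_def\<close>)
  then show ?thesis
    unfolding has_vector_derivative_def power2_norm_eq_inner
    by (rule has_derivative_eq_rhs) (auto simp: inner_commute algebra_simps)
qed

text \<open>The solution is the power series whose \<open>n\<close>-th coefficient is the derivative \<open>w n\<close> of order \<open>n\<close>
  at \<open>t0\<close>, divided by \<open>n!\<close>. Differentiating \<open>x' = M x + b\<close> forces \<open>w (n + 1) = M w n\<close> for \<open>n > 0\<close>, and
  \<open>w n\<close> grows at most geometrically, so that the series converges everywhere, componentwise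
  and together with its derivative.\<close>

lemma linear_ode_solution:
  fixes M :: "real^'n^'n" and b x0 :: "real^'n"
  obtains x where "x t0 = x0" and "\<And>t. (x has_vector_derivative (M *v x t + b)) (at t)"
proof -
  define w where "w = rec_nat x0 (\<lambda>n v. M *v v + (if n = 0 then b else 0))"
  have w_Suc: "w (Suc n) = M *v w n + (if n = 0 then b else 0)" for n
    by (simp add: w_def)
  have w_0: "w 0 = x0" by (simp add: w_def)
  \<comment> \<open>The summand 1 lets the step \<open>n = 0\<close>, where \<open>b\<close> enters, obey the same geometric bound.\<close>
  define K where "K = 1 + onorm ((*v) M)"
  have on: "norm (M *v v) \<le> onorm ((*v) M) * norm v" for v
    by (rule onorm) simp
  have onpos: "0 \<le> onorm ((*v) M)" by (rule onorm_pos_le) simp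
  have K1: "1 \<le> K" using onpos by (simp add: K_def)
  define c where "c = norm x0 + norm b"
  have cpos: "0 \<le> c" by (simp add: c_def)
  have bound: "norm (w n) \<le> c * K ^ n" for n
  proof (induction n)
    case 0
    show ?case by (simp add: w_0 c_def)
  next
    case (Suc n)
    have "norm (w (Suc n)) \<le> norm (M *v w n) + c"
      unfolding w_Suc c_def using norm_triangle_ineq[of "M *v w n" b]
        norm_ge_zero[of x0] norm_ge_zero[of b] by (cases "n = 0"; simp; linarith)
    also have "\<dots> \<le> onorm ((*v) M) * (c * K ^ n) + c * K ^ n"
      using on[of "w n"] mult_left_mono[OF Suc onpos] mult_left_mono[OF one_le_power[OF K1, of n] cpos]
      by simp
    also have "\<dots> = c * K ^ Suc n" by (simp add: K_def algebra_simps)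
    finally show ?case .
  qed
  have summ: "summable (\<lambda>n. (w n $ i / fact n) * t ^ n)" for i t
  proof (rule summable_comparison_test')
    show "summable (\<lambda>n. c * (inverse (fact n) * (K * \<bar>t\<bar>) ^ n))"
      by (intro summable_mult summable_exp)
    show "norm ((w n $ i / fact n) * t ^ n) \<le> c * (inverse (fact n) * (K * \<bar>t\<bar>) ^ n)" for n
    proof -
      have "\<bar>w n $ i\<bar> \<le> c * K ^ n"
        using bound[of n] component_le_norm_cart[of "w n" i] by linarith
      then have "\<bar>w n $ i\<bar> * (inverse (fact n) * \<bar>t\<bar> ^ n) \<le> c * K ^ n * (inverse (fact n) * \<bar>t\<bar> ^ n)"
        by (intro mult_right_mono) auto
      then show ?thesis
        by (simp add: abs_mult power_abs power_mult_distrib divide_inverse ac_simps)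
    qed
  qed
  define f where "f t i = (\<Sum>n. (w n $ i / fact n) * t ^ n)" for t i
  have sumf: "(\<lambda>n. (w n $ i / fact n) * t ^ n) sums f t i" for t i
    unfolding f_def by (rule summable_sums[OF summ])
  define z where "z t = (\<chi> i. f t i)" for t
  have f_deriv: "((\<lambda>t. f t i) has_field_derivative ((M *v z t + b) $ i)) (at t)" for t i
  proof -
    have "(\<lambda>n. (\<Sum>j\<in>UNIV. M $ i $ j * ((w n $ j / fact n) * t ^ n)) + (if n = 0 then b $ i else 0))
        sums ((\<Sum>j\<in>UNIV. M $ i $ j * f t j) + b $ i)"
      by (intro sums_add sums_sum sums_mult sumf sums_single)
    moreover have "(\<Sum>j\<in>UNIV. M $ i $ j * ((w n $ j / fact n) * t ^ n)) + (if n = 0 then b $ i else 0)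
        = diffs (\<lambda>n. w n $ i / fact n) n * t ^ n" for n
    proof -
      have "diffs (\<lambda>n. w n $ i / fact n) n = w (Suc n) $ i / fact n"
        by (simp add: diffs_def field_simps del: of_nat_Suc)
      then show ?thesis
        by (simp add: w_Suc matrix_vector_mult_def sum_distrib_left sum_distrib_right
            sum_divide_distrib mult.assoc divide_inverse)
    qed
    ultimately have "(\<Sum>n. diffs (\<lambda>n. w n $ i / fact n) n * t ^ n) = (M *v z t + b) $ i"
      by (simp add: sums_iff matrix_vector_mult_def z_def)
    with termdiffs_strong_converges_everywhere[OF summ, of i t] show ?thesis
      by (simp add: f_def[abs_def])
  qed
  have z_deriv: "(z has_vector_derivative (M *v z t + b)) (at t)" for t
    unfolding has_vector_derivative_def has_derivative_componentwise_within[of z]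
  proof
    fix e :: "real^'n" assume "e \<in> Basis"
    then obtain i where e: "e = axis i 1" by (auto simp: Basis_vec_def)
    have "((\<lambda>t. f t i) has_derivative (\<lambda>h. h * ((M *v z t + b) $ i))) (at t)"
      using f_deriv[of i t] unfolding has_field_derivative_def
      by (rule has_derivative_eq_rhs) (simp add: fun_eq_iff)
    then show "((\<lambda>t. z t \<bullet> e) has_derivative (\<lambda>h. (h *\<^sub>R (M *v z t + b)) \<bullet> e)) (at t)"
      by (simp add: e z_def inner_axis mult.commute)
  qed
  have z_0: "z 0 = x0"
  proof -
    have "f 0 i = x0 $ i" for i
      using powser_zero[of "\<lambda>n. w n $ i / fact n"] by (simp add: f_def w_0)
    then show ?thesis by (simp add: z_def vec_eq_iff)
  qed
  show ?thesis
  proof (rule that[of "\<lambda>t. z (t - t0)"])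
    show "z (t0 - t0) = x0" by (simp add: z_0)
    show "((\<lambda>t. z (t - t0)) has_vector_derivative (M *v z (t - t0) + b)) (at t)" for t
    proof -
      have "((\<lambda>t. t - t0) has_vector_derivative 1) (at t)"
        by (auto intro!: derivative_eq_intros)
      from vector_diff_chain_at[OF this z_deriv] show ?thesis by (simp add: o_def)
    qed
  qed
qed

text \<open>The interval has nonempty interior, so it has no isolated points and the derivative within
  it is unique, also at its endpoints. For the passage from trajectories to vectors the constant
  input \<open>u0\<close> and the solution starting in \<open>x0\<close> at any one time suffice.\<close>

lemma trajectory_property_iff_pointwise:
  fixes S :: "('n::finite, 'm::finite) lin_system"
    and P :: "real \<Rightarrow> real^'m \<Rightarrow> real^'m \<Rightarrow> bool"
  assumes "is_interval I" and "interior I \<noteq> {}"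
  shows "(\<forall>u x y. trajectory I S u x y \<longrightarrow>
            (\<forall>t\<in>I. P (vector_derivative (\<lambda>s. (norm (x s))\<^sup>2) (at t within I)) (u t) (y t)))
     \<longleftrightarrow> (\<forall>x u. P (2 * (x \<bullet> (sysA S *v x + sysB S *v u))) u (sysC S *v x + sysD S *v u))"
    (is "?L \<longleftrightarrow> ?R")
proof -
  have perfect: "t islimpt I" if "t \<in> I" for t
  proof (rule connected_imp_perfect[OF _ that])
    show "connected I" using assms(1) by (rule is_interval_connected)
    show "I \<noteq> {s}" for s using assms(2) by auto
  qed
  have energy: "vector_derivative (\<lambda>s. (norm (x s))\<^sup>2) (at t within I)
      = 2 * (x t \<bullet> (sysA S *v x t + sysB S *v u t))"
    if "trajectory I S u x y" "t \<in> I" for u x y t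
  proof (rule vector_derivative_within)
    show "at t within I \<noteq> bot" using perfect[OF that(2)] by (simp add: trivial_limit_within)
    show "((\<lambda>s. (norm (x s))\<^sup>2) has_vector_derivative
        2 * (x t \<bullet> (sysA S *v x t + sysB S *v u t))) (at t within I)"
      using that by (intro norm_sq_has_derivative) (auto simp: trajectory_def)
  qed
  show ?thesis
  proof
    assume L: ?L
    obtain t0 where t0: "t0 \<in> I" using assms(2) interior_subset by blast
    show ?R
    proof (intro allI)
      fix x0 u0
      obtain x where x: "x t0 = x0"
        "\<And>t. (x has_vector_derivative (sysA S *v x t + sysB S *v u0)) (at t)"
        using linear_ode_solution[of t0 x0 "sysA S" "sysB S *v u0"] by blast
      have tr: "trajectory I S (\<lambda>_. u0) x (\<lambda>t. sysC S *v x t + sysD S *v u0)"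
        using x(2) by (auto simp: trajectory_def intro: has_vector_derivative_at_within)
      show "P (2 * (x0 \<bullet> (sysA S *v x0 + sysB S *v u0))) u0 (sysC S *v x0 + sysD S *v u0)"
        using L[rule_format, OF tr t0] by (simp add: energy[OF tr t0] x(1))
    qed
  next
    assume R: ?R
    show ?L
    proof (intro allI impI ballI)
      fix u x y t assume tr: "trajectory I S u x y" and t: "t \<in> I"
      have "y t = sysC S *v x t + sysD S *v u t" using tr t by (simp add: trajectory_def)
      then show "P (vector_derivative (\<lambda>s. (norm (x s))\<^sup>2) (at t within I)) (u t) (y t)"
        using R by (simp add: energy[OF tr t])
    qed
  qed
qed

section \<open>Square roots of positive definite matrices\<close>

text \<open>Writing the root of \<open>1 - B\<close> as \<open>1 - Y\<close> turns the equation \<open>(1 - Y)\<^sup>2 = 1 - B\<close> into the fixed point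
  equation \<open>Y = (B + Y\<^sup>2) / 2\<close>. Since \<open>\<parallel>B\<parallel> < 1\<close>, the right-hand side maps the ball of radius \<open>\<parallel>B\<parallel>\<close> into
  itself and contracts it by the factor \<open>\<parallel>B\<parallel>\<close>; it also preserves self-adjointness. Hence Banach's
  fixed point theorem applies. The bound \<open>\<parallel>Y\<parallel> < 1\<close> makes \<open>1 - Y\<close>
  positive definite.\<close>

lemma contraction_square_root:
  fixes B :: "'a::euclidean_space \<Rightarrow>\<^sub>L 'a"
  assumes B1: "norm B < 1" and Bsym: "\<And>v w. B v \<bullet> w = v \<bullet> B w"
  obtains Y :: "'a \<Rightarrow>\<^sub>L 'a" where "norm Y < 1" and "\<And>v w. Y v \<bullet> w = v \<bullet> Y w"
    and "\<And>v. (v - Y v) - Y (v - Y v) = v - B v"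
proof -
  define q where "q = norm B"
  have q: "0 \<le> q" "q < 1" using B1 by (auto simp: q_def)
  define X :: "('a \<Rightarrow>\<^sub>L 'a) set"
    where "X = {Y. norm Y \<le> q \<and> (\<forall>v w. blinfun_apply Y v \<bullet> w = v \<bullet> blinfun_apply Y w)}"
  define F where "F Y = (1/2) *\<^sub>R (B + (Y o\<^sub>L Y))" for Y :: "'a \<Rightarrow>\<^sub>L 'a"
  have "closed X"
    unfolding X_def
    by (intro closed_Collect_conj closed_Collect_all closed_Collect_le closed_Collect_eq continuous_intros)
  then have "complete X" by (simp add: complete_eq_closed)
  moreover have "0 \<in> X" by (simp add: X_def q)
  moreover have "F ` X \<subseteq> X"
  proof
    fix Z assume "Z \<in> F ` X"
    then obtain Y where Y: "Y \<in> X" and Z: "Z = F Y" by auto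
    have "norm (Y o\<^sub>L Y) \<le> q * q"
      using norm_blinfun_compose[of Y Y] Y mult_mono'[of "norm Y" q "norm Y" q] by (auto simp: X_def)
    moreover have "q * q \<le> q" using q by (simp add: mult_left_le)
    ultimately have "norm (B + (Y o\<^sub>L Y)) \<le> 2 * q"
      using norm_triangle_ineq[of B "Y o\<^sub>L Y"] by (simp add: q_def)
    then show "Z \<in> X"
      using Y by (auto simp: Z F_def X_def blinfun.bilinear_simps inner_simps Bsym)
  qed
  moreover have "dist (F Y) (F Z) \<le> q * dist Y Z" if "Y \<in> X" "Z \<in> X" for Y Z
  proof -
    have "F Y - F Z = (1/2) *\<^sub>R ((Y o\<^sub>L (Y - Z)) + ((Y - Z) o\<^sub>L Z))"
      by (rule blinfun_eqI) (simp add: F_def blinfun.bilinear_simps algebra_simps)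
    then have "norm (F Y - F Z) \<le> 1/2 * (norm (Y o\<^sub>L (Y - Z)) + norm ((Y - Z) o\<^sub>L Z))"
      by (simp add: norm_triangle_ineq)
    also have "\<dots> \<le> 1/2 * (norm Y * norm (Y - Z) + norm (Y - Z) * norm Z)"
      by (intro mult_left_mono add_mono norm_blinfun_compose) auto
    also have "\<dots> \<le> 1/2 * (q * norm (Y - Z) + norm (Y - Z) * q)"
      using that by (intro mult_left_mono add_mono mult_right_mono) (auto simp: X_def)
    finally show ?thesis by (simp add: dist_norm)
  qed
  ultimately obtain Y where Y: "Y \<in> X" "F Y = Y"
    using Banach_fix[of X q F] q by blast
  show ?thesis
  proof
    show "norm Y < 1" "Y v \<bullet> w = v \<bullet> Y w" for v w using Y(1) q by (auto simp: X_def)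
    fix v
    have "2 *\<^sub>R Y v = 2 *\<^sub>R F Y v" by (simp add: Y(2))
    also have "\<dots> = B v + Y (Y v)" by (simp add: F_def blinfun.bilinear_simps)
    finally have "Y v + Y v = B v + Y (Y v)" by (simp add: scaleR_2)
    then show "(v - Y v) - Y (v - Y v) = v - B v"
      by (simp add: blinfun.bilinear_simps algebra_simps)
  qed
qed

text \<open>Let \<open>r > 0\<close> be the minimum of the quadratic form on the unit sphere and \<open>N\<close> a bound for the norm
  of \<open>R\<close>. Then \<open>\<parallel>v - c R v\<parallel>\<^sup>2 \<le> (1 - 2 c r + c\<^sup>2 N\<^sup>2) \<parallel>v\<parallel>\<^sup>2\<close>, and \<open>c = r / N\<^sup>2\<close> minimises the factor.\<close>

lemma positive_definite_scaled_near_identity: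
  fixes R :: "real^'m^'m"
  assumes pos: "\<And>v. v \<noteq> 0 \<Longrightarrow> 0 < v \<bullet> (R *v v)"
  obtains c q where "0 < c" and "0 \<le> q" and "q < 1" and "\<And>v. norm (v - c *\<^sub>R (R *v v)) \<le> q * norm v"
proof -
  have "compact (sphere 0 1 :: (real^'m) set)" "sphere 0 1 \<noteq> ({} :: (real^'m) set)"
    by (auto intro!: exI[of _ "axis undefined 1"] simp: norm_axis_1)
  moreover have "continuous_on (sphere 0 1) (\<lambda>v. v \<bullet> (R *v v))"
    by (intro continuous_intros) 
  ultimately have "\<exists>p\<in>sphere 0 1. \<forall>v\<in>sphere 0 1. p \<bullet> (R *v p) \<le> v \<bullet> (R *v v)"
    by (rule continuous_attains_inf)
  then obtain p where p: "p \<in> sphere 0 1"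
    "\<And>v. v \<in> sphere 0 1 \<Longrightarrow> p \<bullet> (R *v p) \<le> v \<bullet> (R *v v)"
    by blast
  define r where "r = p \<bullet> (R *v p)"
  have r: "0 < r" unfolding r_def using p(1) by (intro pos) auto
  have lower: "r * (norm v)\<^sup>2 \<le> v \<bullet> (R *v v)" for v
  proof (cases "v = 0")
    case False
    then have "r \<le> sgn v \<bullet> (R *v sgn v)" unfolding r_def by (intro p(2)) (simp add: norm_sgn)
    also have "\<dots> = (v \<bullet> (R *v v)) / (norm v)\<^sup>2"
      by (simp add: sgn_div_norm matrix_vector_mult_scaleR power2_eq_square field_simps)
    finally show ?thesis using False by (simp add: field_simps)
  qed simp
  \<comment> \<open>Adding 1 makes \<open>N\<close> positive, so that \<open>r / N\<^sup>2\<close> is meaningful.\<close>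
  define N where "N = onorm ((*v) R) + 1"
  have N: "0 < N" using onorm_pos_le[of "(*v) R"] by (simp add: N_def)
  have upper: "norm (R *v v) \<le> N * norm v" for v
  proof -
    have "norm (R *v v) \<le> onorm ((*v) R) * norm v" by (rule onorm) simp
    then show ?thesis using norm_ge_zero[of v] unfolding N_def distrib_right by linarith
  qed
  define c where "c = r / N\<^sup>2"
  define q where "q = sqrt (max 0 (1 - r\<^sup>2 / N\<^sup>2))"
  show ?thesis
  proof
    show "0 < c" using r N by (simp add: c_def)
    show "0 \<le> q" by (simp add: q_def)
    show "q < 1" using r N by (simp add: q_def)
    fix v :: "real^'m"
    have "(norm (v - c *\<^sub>R (R *v v)))\<^sup>2 = (norm v)\<^sup>2 - 2 * c * (v \<bullet> (R *v v)) + c\<^sup>2 * (norm (R *v v))\<^sup>2"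
      unfolding power2_norm_eq_inner
      by (simp add: inner_simps inner_commute power2_eq_square algebra_simps)
    also have "\<dots> \<le> (norm v)\<^sup>2 - 2 * c * (r * (norm v)\<^sup>2) + c\<^sup>2 * (N * norm v)\<^sup>2"
      using \<open>0 < c\<close> lower[of v] upper[of v] by (intro add_mono diff_mono mult_left_mono power_mono) auto
    also have "\<dots> = (1 - r\<^sup>2 / N\<^sup>2) * (norm v)\<^sup>2"
      using N by (simp add: c_def power2_eq_square field_simps)
    also have "\<dots> \<le> max 0 (1 - r\<^sup>2 / N\<^sup>2) * (norm v)\<^sup>2"
      by (intro mult_right_mono) auto
    also have "\<dots> = (q * norm v)\<^sup>2" by (simp add: q_def power_mult_distrib)
    finally show "norm (v - c *\<^sub>R (R *v v)) \<le> q * norm v"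
      by (rule power2_le_imp_le) (simp add: \<open>0 \<le> q\<close>)
  qed
qed

text \<open>After scaling, \<open>c R\<close> lies within distance less than 1 of the identity, so the contraction
  argument yields a root of \<open>c R\<close>; dividing it by \<open>\<surd>c\<close> gives a root of \<open>R\<close>.\<close>

lemma positive_definite_square_root_exists:
  fixes R :: "real^'m^'m"
  assumes sym: "transpose R = R" and pos: "\<And>v. v \<noteq> 0 \<Longrightarrow> 0 < v \<bullet> (R *v v)"
  obtains H where "transpose H = H" and "\<And>v. v \<noteq> 0 \<Longrightarrow> 0 < v \<bullet> (H *v v)" and "H ** H = R"
proof -
  obtain c q where cq: "0 < c" "0 \<le> q" "q < 1" "\<And>v. norm (v - c *\<^sub>R (R *v v)) \<le> q * norm v"
    using positive_definite_scaled_near_identity[OF pos] by metis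
  define B where "B = Blinfun (\<lambda>v. v - c *\<^sub>R (R *v v))"
  have "bounded_linear (\<lambda>v. v - c *\<^sub>R (R *v v))"
    by (intro bounded_linear_intros matrix_vector_mul_bounded_linear)
  then have B: "B v = v - c *\<^sub>R (R *v v)" for v
    by (simp add: B_def bounded_linear_Blinfun_apply)
  have "norm B \<le> q" using cq by (intro norm_blinfun_bound) (auto simp: B)
  then have "norm B < 1" using cq by simp
  moreover have "B v \<bullet> w = v \<bullet> B w" for v w
    by (simp add: B inner_simps dot_symmetric_matrix[OF sym])
  ultimately obtain Y :: "(real^'m) \<Rightarrow>\<^sub>L (real^'m)" where Y: "norm Y < 1" "\<And>v w. Y v \<bullet> w = v \<bullet> Y w"
    "\<And>v. (v - Y v) - Y (v - Y v) = v - B v"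
    using contraction_square_root by blast
  define h where "h v = (1 / sqrt c) *\<^sub>R (v - Y v)" for v
  define H where "H = matrix h"
  have "linear h"
    unfolding h_def
    by (rule linearI) (simp_all add: blinfun.bilinear_simps algebra_simps)
  then have H: "H *v v = h v" for v by (simp add: H_def)
  show ?thesis
  proof
    have "(H *v v) \<bullet> w = v \<bullet> (H *v w)" for v w
      by (simp add: H h_def inner_simps Y(2))
    then have "(v v* H) \<bullet> w = (H *v v) \<bullet> w" for v w by (simp add: dot_lmul_matrix)
    then have "v v* H = H *v v" for v using vector_eq_rdot by blast
    then show "transpose H = H" by (simp add: matrix_eq)
    have "H *v (H *v v) = R *v v" for v
    proof -
      have "H *v (H *v v) = (1 / sqrt c * (1 / sqrt c)) *\<^sub>R ((v - Y v) - Y (v - Y v))"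
        by (simp add: H h_def blinfun.scaleR_right flip: scaleR_diff_right)
      also have "\<dots> = (1 / c) *\<^sub>R (c *\<^sub>R (R *v v))" using cq(1) by (simp add: Y(3) B)
      finally show ?thesis using cq(1) by simp
    qed
    then show "H ** H = R" by (simp add: matrix_eq flip: matrix_vector_mul_assoc)
    fix v :: "real^'m" assume v: "v \<noteq> 0"
    have "v \<bullet> Y v \<le> norm v * norm (Y v)" by (rule norm_cauchy_schwarz)
    also have "\<dots> \<le> norm v * (norm Y * norm v)" by (intro mult_left_mono norm_blinfun) auto
    also have "\<dots> < norm v * norm v" using v Y(1) by simp
    also have "\<dots> = v \<bullet> v" by (simp add: power2_norm_eq_inner flip: power2_eq_square)
    finally show "0 < v \<bullet> (H *v v)" using cq(1) by (simp add: H h_def inner_simps)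
  qed
qed

text \<open>The trace of a congruence sums the quadratic form of \<open>M\<close> over the columns of \<open>D\<close>. For positive
  \<open>M\<close> it is thus nonnegative, and for positive definite \<open>M\<close> it vanishes only if \<open>D = 0\<close>.\<close>

lemma trace_congruence:
  fixes D M :: "real^'m^'m"
  assumes "transpose D = D"
  shows "trace (D ** M ** D) = (\<Sum>i\<in>UNIV. (D *v axis i 1) \<bullet> (M *v (D *v axis i 1)))"
proof -
  have "(D ** M ** D) $ i $ i = (D *v axis i 1) \<bullet> (M *v (D *v axis i 1))" for i
  proof -
    have "(D ** M ** D) $ i $ i = axis i 1 \<bullet> ((D ** M ** D) *v axis i 1)"
      by (simp add: inner_axis' matrix_vector_mult_basis column_def)
    also have "\<dots> = axis i 1 \<bullet> (D *v (M *v (D *v axis i 1)))"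
      by (simp add: matrix_vector_mul_assoc matrix_mul_assoc)
    finally show ?thesis by (simp add: dot_symmetric_matrix[OF assms])
  qed
  then show ?thesis by (simp add: trace_def)
qed

text \<open>With \<open>D = G - H\<close> the equation
  \<open>G\<^sup>2 = H\<^sup>2\<close> says \<open>D G + H D = 0\<close>, and multiplying by \<open>D\<close> and taking traces gives
  \<open>tr (D G D) + tr (D H D) = 0\<close>. Both terms are nonnegative, so both vanish, and
  \<open>H\<close> being positive definite, \<open>D = 0\<close>.\<close>

lemma positive_square_root_unique:
  fixes G H :: "real^'m^'m"
  assumes G: "transpose G = G" "\<And>v. 0 \<le> v \<bullet> (G *v v)"
    and H: "transpose H = H" "\<And>v. v \<noteq> 0 \<Longrightarrow> 0 < v \<bullet> (H *v v)"
    and eq: "G ** G = H ** H"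
  shows "G = H"
proof -
  define D where "D = G - H"
  have D: "transpose D = D" using G(1) H(1) by (simp add: D_def transpose_def vec_eq_iff)
  have "(D ** G + H ** D) *v v = 0" for v
    using arg_cong[OF eq, of "\<lambda>M. M *v v"]
    by (simp add: D_def matrix_vector_mult_diff_rdistrib matrix_vector_mult_diff_distrib
        matrix_vector_mult_add_rdistrib flip: matrix_vector_mul_assoc)
  then have "D ** G + H ** D = 0" by (simp add: matrix_eq)
  then have "trace (D ** (D ** G + H ** D)) = 0" by (simp add: trace_def)
  then have "trace (D ** (D ** G)) + trace (D ** H ** D) = 0"
    by (simp add: matrix_add_ldistrib matrix_mul_assoc trace_add)
  moreover have "trace (D ** (D ** G)) = trace (D ** G ** D)"
    by (rule trace_mul_sym)
  moreover have "0 \<le> trace (D ** G ** D)"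
    by (simp add: trace_congruence[OF D] G(2) sum_nonneg)
  moreover have Hnn: "0 \<le> v \<bullet> (H *v v)" for v
    using H(2)[of v] by (cases "v = 0") auto
  moreover have "0 \<le> trace (D ** H ** D)"
    by (simp add: trace_congruence[OF D] Hnn sum_nonneg)
  ultimately have "(\<Sum>i\<in>UNIV. (D *v axis i 1) \<bullet> (H *v (D *v axis i 1))) = 0"
    by (simp add: trace_congruence[OF D])
  then have "(D *v axis i 1) \<bullet> (H *v (D *v axis i 1)) = 0" for i
    using Hnn by (simp add: sum_nonneg_eq_0_iff)
  then have "D *v axis i 1 = 0" for i using H(2) by (metis less_irrefl)
  then have "D = 0" by (simp add: matrix_vector_mult_basis column_def vec_eq_iff)
  then show ?thesis by (simp add: D_def)
qed

text \<open>This is where the definite description in \<^const>\<open>mat_sqrt\<close> is shown to denote.\<close>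

lemma mat_sqrt_resistance:
  fixes R :: "real^('k::finite + 'k)^('k + 'k)"
  assumes "resistance_matrix R"
  shows "transpose (mat_sqrt R) = mat_sqrt R" and "mat_sqrt R ** mat_sqrt R = R"
    and "invertible (mat_sqrt R)"
proof -
  have R: "transpose R = R" "\<And>v. v \<noteq> 0 \<Longrightarrow> 0 < v \<bullet> (R *v v)"
    using assms unfolding resistance_matrix_def by blast+
  obtain H where H: "transpose H = H" "\<And>v. v \<noteq> 0 \<Longrightarrow> 0 < v \<bullet> (H *v v)" "H ** H = R"
    using positive_definite_square_root_exists[OF R] by blast
  have "mat_sqrt R = H"
    unfolding mat_sqrt_def
  proof (rule the_equality)
    have "0 \<le> v \<bullet> (H *v v)" for v using H(2)[of v] by (cases "v = 0") auto
    with H show "transpose H = H \<and> (\<forall>v. 0 \<le> v \<bullet> (H *v v)) \<and> H ** H = R" by auto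
    show "G = H" if "transpose G = G \<and> (\<forall>v. 0 \<le> v \<bullet> (G *v v)) \<and> G ** G = R" for G
    proof (rule positive_square_root_unique)
      show "transpose G = G" and "0 \<le> v \<bullet> (G *v v)" and "G ** G = H ** H" for v
        using that by (simp_all add: H(3))
    qed (fact H)+
  qed
  then show "transpose (mat_sqrt R) = mat_sqrt R" and "mat_sqrt R ** mat_sqrt R = R"
    and "invertible (mat_sqrt R)"
    using H(1,3) invertible_if_positive_definite[OF H(2)] by simp_all
qed

section \<open>The external Cayley transform as a change of signals\<close>

lemma resistance_matrix_identity: "resistance_matrix (mat 1 :: real^('k::finite + 'k)^('k + 'k))"
proof -
  have "(mat 1 :: real^('k + 'k)^('k + 'k)) = block_diag (mat 1) (mat 1)"
    by (auto simp: block_diag_def mat_def vec_eq_iff split: sum.split)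
  then have "\<exists>P Q. (mat 1 :: real^('k + 'k)^('k + 'k)) = block_diag P Q" by blast
  moreover have "invertible (mat 1 :: real^('k + 'k)^('k + 'k))"
    by (auto simp: invertible_def intro: exI[of _ "mat 1"])
  ultimately show ?thesis by (simp add: resistance_matrix_def)
qed

text \<open>The relation \<open>\<surd>2 H a = y + R u\<close> together with \<open>y = C x + D u\<close> reads
  \<open>(D + R) u = \<surd>2 H a - C x\<close>. Solving for \<open>u\<close> and substituting produces exactly the coefficients of
  the transform, with output \<open>b = a - \<surd>2 H u\<close>; this is \<open>\<surd>2 H b = y - R u\<close> solved for \<open>b\<close>. The power
  identity is the polarisation \<open>\<parallel>a\<parallel>\<^sup>2 - \<parallel>b\<parallel>\<^sup>2 = \<langle>a - b, a + b\<rangle>\<close>.\<close>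

lemma external_cayley_wave_variables:
  fixes S :: "('n::finite, 'k::finite + 'k) lin_system" and x :: "real^'n"
  assumes R: "resistance_matrix R" and ex: "cayley_exists S R"
    and y: "y = sysC S *v x + sysD S *v u"
    and a: "sqrt 2 *\<^sub>R (mat_sqrt R *v a) = y + R *v u"
  defines "T \<equiv> external_cayley S R"
  defines "b \<equiv> sysC T *v x + sysD T *v a"
  shows "sysA T *v x + sysB T *v a = sysA S *v x + sysB S *v u"
    and "(norm a)\<^sup>2 - (norm b)\<^sup>2 = 2 * (u \<bullet> y)"
proof -
  define H where "H = mat_sqrt R"
  define K where "K = matrix_inv (sysD S + R)"
  note Hs = mat_sqrt_resistance[OF R, folded H_def]
  have HH: "H *v (H *v v) = R *v v" for v using Hs(2) by (simp add: matrix_vector_mul_assoc)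
  have "(sysD S + R) *v u = sqrt 2 *\<^sub>R (H *v a) - sysC S *v x"
    using a y by (simp add: H_def matrix_vector_mult_add_rdistrib)
  then have "K *v ((sysD S + R) *v u) = K *v (sqrt 2 *\<^sub>R (H *v a) - sysC S *v x)" by simp
  moreover have "K ** (sysD S + R) = mat 1"
    using ex unfolding K_def cayley_exists_def by (rule matrix_inv_inverse)
  ultimately have u: "u = sqrt 2 *\<^sub>R (K *v (H *v a)) - K *v (sysC S *v x)"
    by (simp add: matrix_vector_mul_assoc matrix_vector_mult_diff_distrib matrix_vector_mult_scaleR)
  have T: "sysA T = sysA S - sysB S ** K ** sysC S" "sysB T = sqrt 2 *\<^sub>R (sysB S ** K ** H)"
    "sysC T = sqrt 2 *\<^sub>R (H ** K ** sysC S)" "sysD T = mat 1 - 2 *\<^sub>R (H ** K ** H)"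
    by (simp_all add: T_def external_cayley_def Let_def H_def K_def)
  show "sysA T *v x + sysB T *v a = sysA S *v x + sysB S *v u"
    by (simp add: T u matrix_vector_mult_diff_rdistrib matrix_vector_mult_diff_distrib
        matrix_vector_mult_scaleR flip: matrix_vector_mul_assoc scaleR_matrix_vector_assoc)
  have b: "b = a - sqrt 2 *\<^sub>R (H *v u)"
    by (simp add: b_def T u matrix_vector_mult_diff_rdistrib matrix_vector_mult_diff_distrib
        matrix_vector_mult_scaleR scaleR_diff_right flip: matrix_vector_mul_assoc scaleR_matrix_vector_assoc)
  have "(norm a)\<^sup>2 - (norm b)\<^sup>2 = 2 * (sqrt 2 * (a \<bullet> (H *v u)) - (H *v u) \<bullet> (H *v u))"
    by (simp add: b power2_norm_eq_inner inner_simps inner_commute algebra_simps)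
  also have "sqrt 2 * (a \<bullet> (H *v u)) = (sqrt 2 *\<^sub>R (H *v a)) \<bullet> u"
    by (simp add: dot_symmetric_matrix[OF Hs(1)])
  also have "\<dots> = y \<bullet> u + (R *v u) \<bullet> u" using a by (simp add: H_def inner_simps)
  also have "(H *v u) \<bullet> (H *v u) = (R *v u) \<bullet> u"
    by (simp add: HH dot_symmetric_matrix[OF Hs(1)] inner_commute)
  finally show "(norm a)\<^sup>2 - (norm b)\<^sup>2 = 2 * (u \<bullet> y)" by (simp add: inner_commute)
qed

text \<open>For fixed \<open>x\<close>, invertibility of \<open>H\<close> makes every \<open>u\<close> correspond to some \<open>a\<close>, and invertibility of
  \<open>D + R\<close> makes every \<open>a\<close> correspond to some \<open>u\<close>. Corresponding inputs have the same stored and the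
  same supplied power, so the two universal statements range over the same pairs of numbers.\<close>

lemma external_cayley_pointwise:
  fixes S :: "('n::finite, 'k::finite + 'k) lin_system"
    and P :: "real \<Rightarrow> real \<Rightarrow> bool"
  assumes R: "resistance_matrix R" and ex: "cayley_exists S R"
  defines "T \<equiv> external_cayley S R"
  shows "(\<forall>x u. P (2 * (x \<bullet> (sysA S *v x + sysB S *v u))) (2 * (u \<bullet> (sysC S *v x + sysD S *v u))))
    \<longleftrightarrow> (\<forall>x a. P (2 * (x \<bullet> (sysA T *v x + sysB T *v a)))
          ((norm a)\<^sup>2 - (norm (sysC T *v x + sysD T *v a))\<^sup>2))"
    (is "(\<forall>x u. ?imp x u) \<longleftrightarrow> (\<forall>x a. ?scat x a)")
proof -
  define H where "H = mat_sqrt R"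
  define Hi where "Hi = matrix_inv H"
  define K where "K = matrix_inv (sysD S + R)"
  have HHi: "H *v (Hi *v v) = v" for v
    using matrix_inv_inverse(1)[of H] mat_sqrt_resistance(3)[OF R]
    by (simp add: Hi_def H_def matrix_vector_mul_assoc)
  have KI: "(sysD S + R) *v (K *v v) = v" for v
    using matrix_inv_inverse(1)[of "sysD S + R"] ex
    by (simp add: K_def cayley_exists_def matrix_vector_mul_assoc)
  have corr: "?imp x u \<longleftrightarrow> ?scat x a"
    if "sqrt 2 *\<^sub>R (H *v a) = (sysC S *v x + sysD S *v u) + R *v u" for x u a
    using external_cayley_wave_variables[OF R ex refl that[unfolded H_def]] by (simp add: T_def)
  have "\<exists>a. sqrt 2 *\<^sub>R (H *v a) = (sysC S *v x + sysD S *v u) + R *v u" for x u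
    by (rule exI[of _ "Hi *v ((1 / sqrt 2) *\<^sub>R ((sysC S *v x + sysD S *v u) + R *v u))"])
      (simp add: HHi)
  moreover have "\<exists>u. sqrt 2 *\<^sub>R (H *v a) = (sysC S *v x + sysD S *v u) + R *v u" for x a
  proof
    let ?u = "K *v (sqrt 2 *\<^sub>R (H *v a) - sysC S *v x)"
    show "sqrt 2 *\<^sub>R (H *v a) = (sysC S *v x + sysD S *v ?u) + R *v ?u"
      using KI[of "sqrt 2 *\<^sub>R (H *v a) - sysC S *v x"]
      by (simp add: matrix_vector_mult_add_rdistrib algebra_simps)
  qed
  ultimately show ?thesis by (meson corr)
qed

lemma cayley_exists_if_pointwise_passive:
  fixes S :: "('n::finite, 'k::finite + 'k) lin_system"
  assumes R: "resistance_matrix R"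
    and "\<And>x u. 2 * (x \<bullet> (sysA S *v x + sysB S *v u)) \<le> 2 * (u \<bullet> (sysC S *v x + sysD S *v u))"
  shows "cayley_exists S R"
  unfolding cayley_exists_def
proof (rule invertible_if_positive_definite)
  fix u :: "real^('k + 'k)" assume "u \<noteq> 0"
  then have "0 < u \<bullet> (R *v u)" using R by (simp add: resistance_matrix_def)
  moreover have "0 \<le> u \<bullet> (sysD S *v u)" using assms(2)[of 0 u] by simp
  ultimately show "0 < u \<bullet> ((sysD S + R) *v u)"
    by (simp add: matrix_vector_mult_add_rdistrib inner_simps)
qed

theorem proposition12:
  fixes I :: "real set"
    and S :: "('n::finite, 'k::finite + 'k) lin_system"
  assumes "is_interval I" and "interior I \<noteq> {}"
  shows "((impedance_passive I S \<longleftrightarrow>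
            (\<exists>R. resistance_matrix R \<and> cayley_exists S R \<and>
                 scattering_passive I (external_cayley S R))) \<and>
          (impedance_passive I S \<longleftrightarrow>
            (\<forall>R. resistance_matrix R \<longrightarrow> cayley_exists S R \<and>
                 scattering_passive I (external_cayley S R)))) \<and>
         ((impedance_conservative I S \<longleftrightarrow>
            (\<exists>R. resistance_matrix R \<and> cayley_exists S R \<and>
                 scattering_conservative I (external_cayley S R))) \<and>
          (impedance_conservative I S \<longleftrightarrow>
            (\<forall>R. resistance_matrix R \<longrightarrow> cayley_exists S R \<and>
                 scattering_conservative I (external_cayley S R))))"
proof -
  let ?T = "external_cayley S"
  note pointwise = trajectory_property_iff_pointwise[OF assms]
  have imp_pass: "impedance_passive I S \<longleftrightarrow> (\<forall>x u.
      2 * (x \<bullet> (sysA S *v x + sysB S *v u)) \<le> 2 * (u \<bullet> (sysC S *v x + sysD S *v u)))"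
    unfolding impedance_passive_def by (rule pointwise)
  have imp_cons: "impedance_conservative I S \<longleftrightarrow> (\<forall>x u.
      2 * (x \<bullet> (sysA S *v x + sysB S *v u)) = 2 * (u \<bullet> (sysC S *v x + sysD S *v u)))"
    unfolding impedance_conservative_def by (rule pointwise)
  have pass: "impedance_passive I S \<longleftrightarrow> scattering_passive I (?T R)"
    if "resistance_matrix R" "cayley_exists S R" for R
    unfolding imp_pass scattering_passive_def external_cayley_pointwise[OF that, of "(\<le>)"]
    by (rule pointwise[symmetric])
  have cons: "impedance_conservative I S \<longleftrightarrow> scattering_conservative I (?T R)"
    if "resistance_matrix R" "cayley_exists S R" for R
    unfolding imp_cons scattering_conservative_def external_cayley_pointwise[OF that, of "(=)"]
    by (rule pointwise[symmetric])
  have ex_pass: "cayley_exists S R" if "resistance_matrix R" "impedance_passive I S" for R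
    using that unfolding imp_pass by (intro cayley_exists_if_pointwise_passive) auto
  have ex_cons: "cayley_exists S R" if "resistance_matrix R" "impedance_conservative I S" for R
    using that unfolding imp_cons by (intro cayley_exists_if_pointwise_passive) auto
  note one = resistance_matrix_identity[where 'k = 'k]
  show ?thesis
  proof (intro conjI)
    show "impedance_passive I S \<longleftrightarrow> (\<exists>R. resistance_matrix R \<and> cayley_exists S R \<and>
        scattering_passive I (?T R))"
      using pass ex_pass one by meson
    show "impedance_passive I S \<longleftrightarrow> (\<forall>R. resistance_matrix R \<longrightarrow> cayley_exists S R \<and>
        scattering_passive I (?T R))"
      using pass ex_pass one by meson
    show "impedance_conservative I S \<longleftrightarrow> (\<exists>R. resistance_matrix R \<and> cayley_exists S R \<and>
        scattering_conservative I (?T R))"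
      using cons ex_cons one by meson
    show "impedance_conservative I S \<longleftrightarrow> (\<forall>R. resistance_matrix R \<longrightarrow> cayley_exists S R \<and>
        scattering_conservative I (?T R))"
      using cons ex_cons one by meson
  qed
qed

end
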